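(* For all integers $n\ge 2$, $k\ge 2$ and $1\le l\le k-1$, the numbers $$\frac{1}{\pi^{n}}S(n,k,l)=\frac{1}{\pi^n}\sum_{j=-\infty}^{\infty}\frac{1}{(jk+l)^{n}}\qquad\text{and}\qquad \frac{1}{\pi^{n}}\hat S(n,k,l)=\frac{1}{\pi^n}\sum_{j=-\infty}^{\infty}\frac{(-1)^{j}}{(jk+l)^{n}}$$ are algebraic numbers.
   Context: For integers $n\ge2$, $k\ge2$ and $l$ not divisible by $k$, $S(n,k,l)=\sum_{j\in\mathbb Z}(jk+l)^{-n}$ and $\hat S(n,k,l)=\sum_{j\in\mathbb Z}(-1)^j(jk+l)^{-n}$ (absolutely convergent sums over all integers $j$). *)

theory Defs
  imports "HOL-Analysis.Analysis" "HOL-Computational_Algebra.Polynomial"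
begin

definition S :: "nat \<Rightarrow> int \<Rightarrow> int \<Rightarrow> real" where
  "S n k l = (\<Sum>\<^sub>\<infinity>j::int. 1 / real_of_int (j * k + l) ^ n)"

definition S_hat :: "nat \<Rightarrow> int \<Rightarrow> int \<Rightarrow> real" where
  "S_hat n k l = (\<Sum>\<^sub>\<infinity>j::int. (-1) powi j / real_of_int (j * k + l) ^ n)"

text \<open>
  For \<open>n \<ge> 2\<close> and \<open>k \<noteq> 0\<close> both series converge absolutely, so the default value that
  \<^const>\<open>infsum\<close> assigns to non-summable families plays no role. When \<open>k\<close> divides \<open>l\<close> one
  term has denominator zero and is dropped because \<open>x / 0 = 0\<close>; this does not occur
  for \<open>1 \<le> l \<le> k - 1\<close>.
\<close>

lemma inverse_power_int_abs_summable:
  assumes "n \<ge> 2"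
  shows "(\<lambda>m::int. norm (1 / real_of_int m ^ n)) summable_on UNIV"
proof -
  let ?f = "\<lambda>m::int. norm (1 / real_of_int m ^ n)"
  have "summable (\<lambda>i. norm (1 / real i ^ n))"
    using inverse_power_summable[OF assms, where 'a = real]
    by (simp add: norm_power norm_divide inverse_eq_divide)
  hence nat: "(\<lambda>i. norm (1 / real i ^ n)) summable_on UNIV"
    by (intro norm_summable_imp_summable_on) simp
  have 1: "?f summable_on range int"
    using nat by (subst summable_on_reindex) (auto simp: o_def inj_on_def)
  have 2: "?f summable_on range (\<lambda>i. - int i)"
    using nat
    by (subst summable_on_reindex) (auto simp: o_def inj_on_def norm_divide norm_power power_abs)
  have "(UNIV :: int set) = range int \<union> range (\<lambda>i. - int i)"
    by (auto intro: int_cases2)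
  thus ?thesis
    using summable_on_union[OF 1 2] by simp
qed

lemma S_abs_summable:
  assumes "n \<ge> 2" "k \<noteq> 0"
  shows "(\<lambda>j::int. norm (1 / real_of_int (j * k + l) ^ n)) summable_on UNIV"
proof -
  have inj: "inj (\<lambda>j::int. j * k + l)"
    using assms(2) by (auto simp: inj_on_def)
  have "(\<lambda>m::int. norm (1 / real_of_int m ^ n)) summable_on range (\<lambda>j. j * k + l)"
    using inverse_power_int_abs_summable[OF assms(1)] by (rule summable_on_subset_banach) simp
  thus ?thesis
    unfolding summable_on_reindex[OF inj] o_def .
qed

lemma S_hat_abs_summable:
  assumes "n \<ge> 2" "k \<noteq> 0"
  shows "(\<lambda>j::int. norm ((-1) powi j / real_of_int (j * k + l) ^ n)) summable_on UNIV"
proof -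
  have "norm ((-1) powi j / real_of_int (j * k + l) ^ n) = norm (1 / real_of_int (j * k + l) ^ n)"
    for j :: int
    by (simp add: norm_divide power_int_abs)
  thus ?thesis
    using S_abs_summable[OF assms] by simp
qed

end

(* Put x = l/k. Splitting S(n,k,l) at j = 0 expresses it through Polygamma (n - 1) at x and 1 - x.
   Differentiating the reflection formula Digamma (1 - x) - Digamma x = pi * cot (pi * x)
   n - 1 times, and using cot' = -(1 + cot^2), shows that S(n,k,l) / pi^n is a polynomial in
   cot (pi * l / k) with rational coefficients, and this cotangent is algebraic.
   The alternating sum is the difference S(n,2k,l) - S(n,2k,l+k) over even and odd j.
   Sums and products of algebraic numbers x, y are algebraic because the monomials x^i y^j
   of bounded degree span a finite-dimensional rational vector space stable under both. *)

theory Submission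
  imports Defs
begin

section \<open>Closure of algebraic numbers under field operations\<close>

interpretation rat_space: vector_space "\<lambda>q x. of_rat q * x :: 'a :: field_char_0"
  by unfold_locales (simp_all add: algebra_simps of_rat_add of_rat_mult)

text \<open>Multiplication by \<open>a\<close> is linear over the rationals, so stability of a span
  needs checking only on its generators.\<close>

lemma rat_space_mult_span:
  fixes a :: "'a :: field_char_0"
  assumes "\<And>b. b \<in> B \<Longrightarrow> a * b \<in> rat_space.span B" and "v \<in> rat_space.span B"
  shows "a * v \<in> rat_space.span B"
  using assms(2)
proof (induction rule: rat_space.span_induct_alt)
  case base
  show ?case by (simp add: rat_space.span_zero)
next
  case (step c b v)
  have "a * (of_rat c * b + v) = of_rat c * (a * b) + a * v"
    by (simp add: algebra_simps)
  with step assms(1) show ?case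
    by (simp add: rat_space.span_add rat_space.span_scale)
qed

text \<open>Starting from 1, stability puts every power of \<open>a\<close> into one
  finite-dimensional space, so the first \<open>card B + 1\<close> powers satisfy a nontrivial
  rational relation, which is a polynomial equation for \<open>a\<close>.\<close>

lemma algebraic_if_stable_rat_span:
  fixes a :: "'a :: field_char_0"
  assumes "finite B" and "1 \<in> rat_space.span B"
    and stable: "\<And>b. b \<in> B \<Longrightarrow> a * b \<in> rat_space.span B"
  shows "algebraic a"
\<comment> \<open>The dependence bound counts the elements of a set, so coinciding powers are
  treated apart; they yield the polynomial X^i - X^j at once.\<close>
proof (cases "inj_on (\<lambda>i. a ^ i) {..card B}")
  case True
  let ?P = "(\<lambda>i. a ^ i) ` {..card B}"
  have "a ^ i \<in> rat_space.span B" for i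
  proof (induction i)
    case (Suc i)
    then show ?case using rat_space_mult_span[OF stable] by simp
  qed (use assms in simp)
  hence "?P \<subseteq> rat_space.span B" by auto
  moreover have "card ?P = Suc (card B)"
    using True by (simp add: card_image)
  ultimately have "rat_space.dependent ?P"
    using rat_space.independent_span_bound[OF assms(1), of ?P] by auto
  then obtain u v where "v \<in> ?P" "u v \<noteq> 0" and sum0: "(\<Sum>v\<in>?P. of_rat (u v) * v) = 0"
    by (subst (asm) rat_space.dependent_finite) auto
  then obtain i where i: "i \<le> card B" "u (a ^ i) \<noteq> 0" by auto
  \<comment> \<open>The relation indexes its coefficients by the values \<open>a ^ j\<close>;
    injectivity lets the sum over these values be read as a sum over exponents, that is, as
    \<open>poly p a\<close>.\<close>
  define p where "p = (\<Sum>j\<le>card B. monom (of_rat (u (a ^ j)) :: 'a) j)"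
  have coeff: "coeff p j = (if j \<le> card B then of_rat (u (a ^ j)) else 0)" for j
    by (simp add: p_def coeff_sum)
  show ?thesis
  proof (rule algebraicI')
    show "coeff p j \<in> \<rat>" for j by (simp add: coeff)
    have "coeff p i \<noteq> 0" using i by (simp add: coeff)
    thus "p \<noteq> 0" by auto
    show "poly p a = 0"
      using sum0 True by (simp add: p_def poly_sum poly_monom sum.reindex)
  qed
next
  case False
  then obtain i j where ij: "i \<noteq> j" "a ^ i = a ^ j" by (auto simp: inj_on_def)
  show ?thesis
  proof (rule algebraicI')
    let ?p = "monom 1 i - monom 1 j :: 'a poly"
    show "coeff ?p m \<in> \<rat>" for m by simp
    have "coeff ?p i \<noteq> 0" using ij by simp
    thus "?p \<noteq> 0" by (metis coeff_0)
    show "poly ?p a = 0" using ij by (simp add: poly_monom)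
  qed
qed

text \<open>Dividing a rational polynomial with root \<open>x\<close> by its leading coefficient
  gives a rule that rewrites \<open>x ^ d\<close> in lower powers.\<close>

lemma algebraic_power_eq_rat_combination:
  fixes x :: "'a :: field_char_0"
  assumes "algebraic x"
  obtains d r where "d > 0" "x ^ d = (\<Sum>i<d. of_rat (r i) * x ^ i)"
proof -
  from assms obtain p where p: "\<And>i. coeff p i \<in> \<rat>" "p \<noteq> 0" "poly p x = 0"
    unfolding algebraic_altdef by blast
  define d where "d = degree p"
  have "\<exists>q. - coeff p i / coeff p d = of_rat q" for i
    using p(1) by (metis Rats_cases Rats_divide Rats_minus_iff)
  then obtain r where r: "\<And>i. - coeff p i / coeff p d = of_rat (r i)" by metis
  have lead: "coeff p d \<noteq> 0" using p(2) by (simp add: d_def)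
  have "0 = (\<Sum>i<d. coeff p i * x ^ i) + coeff p d * x ^ d"
    using p(3) by (simp add: poly_altdef d_def flip: lessThan_Suc_atMost)
  hence "x ^ d = - (\<Sum>i<d. coeff p i * x ^ i) / coeff p d"
    using lead by (simp add: field_simps eq_neg_iff_add_eq_0)
  also have "\<dots> = (\<Sum>i<d. of_rat (r i) * x ^ i)"
    by (simp add: sum_divide_distrib flip: r sum_negf)
  finally have eq: "x ^ d = (\<Sum>i<d. of_rat (r i) * x ^ i)" .
  \<comment> \<open>For \<open>d = 0\<close> the relation would read 1 = 0.\<close>
  moreover have "d > 0" using eq by (cases d) auto
  ultimately show ?thesis using that by blast
qed

lemma algebraic_pair_stable_rat_span:
  fixes x y :: "'a :: field_char_0"
  assumes "algebraic x" "algebraic y"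
  obtains B where "finite B" "1 \<in> rat_space.span B"
    "\<And>b. b \<in> B \<Longrightarrow> x * b \<in> rat_space.span B" "\<And>b. b \<in> B \<Longrightarrow> y * b \<in> rat_space.span B"
proof -
  obtain d r where d: "d > 0" "x ^ d = (\<Sum>i<d. of_rat (r i) * x ^ i)"
    using algebraic_power_eq_rat_combination[OF assms(1)] .
  obtain e s where e: "e > 0" "y ^ e = (\<Sum>j<e. of_rat (s j) * y ^ j)"
    using algebraic_power_eq_rat_combination[OF assms(2)] .
  define B where "B = (\<lambda>(i, j). x ^ i * y ^ j) ` ({..<d} \<times> {..<e})"
  have B: "x ^ i * y ^ j \<in> rat_space.span B" if "i < d" "j < e" for i j
    using that by (intro rat_space.span_base) (auto simp: B_def)
  show ?thesis
  proof
    show "finite B" by (simp add: B_def)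
    show "1 \<in> rat_space.span B" using B[of 0 0] d e by simp
  next
    fix b assume "b \<in> B"
    then obtain i j where ij: "i < d" "j < e" "b = x ^ i * y ^ j" by (auto simp: B_def)
    have "x ^ Suc i * y ^ j \<in> rat_space.span B"
    proof (cases "Suc i = d")
      \<comment> \<open>At the top exponent the product leaves the range of \<open>B\<close>; the
        relation for \<open>x ^ d\<close> brings it back into the span.\<close>
      case True
      have "x ^ Suc i * y ^ j = (\<Sum>m<d. of_rat (r m) * (x ^ m * y ^ j))"
        by (simp only: True d(2) sum_distrib_right mult.assoc)
      also have "\<dots> \<in> rat_space.span B"
        using ij by (intro rat_space.span_sum rat_space.span_scale B) auto
      finally show ?thesis .
    qed (use ij in \<open>intro B, auto\<close>)
    thus "x * b \<in> rat_space.span B" by (simp add: ij mult.assoc)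
    have "x ^ i * y ^ Suc j \<in> rat_space.span B"
    proof (cases "Suc j = e")
      case True
      have "x ^ i * y ^ Suc j = (\<Sum>m<e. of_rat (s m) * (x ^ i * y ^ m))"
        by (simp only: True e(2) sum_distrib_left mult.left_commute)
      also have "\<dots> \<in> rat_space.span B"
        using ij by (intro rat_space.span_sum rat_space.span_scale B) auto
      finally show ?thesis .
    qed (use ij in \<open>intro B, auto\<close>)
    thus "y * b \<in> rat_space.span B" by (simp add: ij mult.left_commute)
  qed
qed

lemma algebraic_add:
  fixes x y :: "'a :: field_char_0"
  assumes "algebraic x" "algebraic y"
  shows "algebraic (x + y)"
proof -
  obtain B where B: "finite B" "1 \<in> rat_space.span B"
    "\<And>b. b \<in> B \<Longrightarrow> x * b \<in> rat_space.span B" "\<And>b. b \<in> B \<Longrightarrow> y * b \<in> rat_space.span B"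
    using algebraic_pair_stable_rat_span[OF assms] by metis
  show ?thesis
    using B by (intro algebraic_if_stable_rat_span[of B])
      (simp_all add: distrib_right rat_space.span_add)
qed

lemma algebraic_mult:
  fixes x y :: "'a :: field_char_0"
  assumes "algebraic x" "algebraic y"
  shows "algebraic (x * y)"
proof -
  obtain B where B: "finite B" "1 \<in> rat_space.span B"
    "\<And>b. b \<in> B \<Longrightarrow> x * b \<in> rat_space.span B" "\<And>b. b \<in> B \<Longrightarrow> y * b \<in> rat_space.span B"
    using algebraic_pair_stable_rat_span[OF assms] by metis
  show ?thesis
    \<comment> \<open>Here \<open>y * b\<close> is in the span but perhaps not in \<open>B\<close>,
      so the stability of the whole span under \<open>x\<close> is what is used.\<close>
    using B by (intro algebraic_if_stable_rat_span[of B])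
      (simp_all add: mult.assoc rat_space_mult_span)
qed

lemma algebraic_diff:
  fixes x y :: "'a :: field_char_0"
  shows "algebraic x \<Longrightarrow> algebraic y \<Longrightarrow> algebraic (x - y)"
  using algebraic_add[of x "- y"] by simp

lemma algebraic_divide:
  fixes x y :: "'a :: field_char_0"
  shows "algebraic x \<Longrightarrow> algebraic y \<Longrightarrow> algebraic (x / y)"
  by (simp add: divide_inverse algebraic_mult algebraic_inverse)

lemma algebraic_poly:
  fixes x :: "'a :: field_char_0"
  assumes "\<And>i. coeff p i \<in> \<rat>" "algebraic x"
  shows "algebraic (poly p x)"
  using assms(1)
proof (induction p)
  case (pCons a p)
  have "a \<in> \<rat>" using pCons.prems[of 0] by simp
  moreover have "coeff p i \<in> \<rat>" for i using pCons.prems[of "Suc i"] by simp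
  ultimately show ?case
    using pCons.IH assms(2) by (simp add: algebraic_add algebraic_mult rat_imp_algebraic)
qed simp

section \<open>Trigonometric values at rational multiples of pi\<close>

text \<open>The cosine is half the sum of a root of unity and its conjugate.\<close>

lemma algebraic_cos_rat_pi:
  assumes "q \<in> \<rat>"
  shows "algebraic (cos (pi * q))"
proof -
  obtain a b :: int where ab: "b > 0" "q = of_int a / of_int b"
    using assms by (metis Rats_cases')
  define \<omega> where "\<omega> = cis (pi * q)"
  \<comment> \<open>Twice the denominator of \<open>q\<close> makes \<open>m * pi * q\<close> a
    multiple of 2 pi.\<close>
  define m where "m = nat (2 * b)"
  have "\<omega> ^ m = cis (real m * (pi * q))"
    by (simp only: \<omega>_def Complex.DeMoivre)
  also have "real m * (pi * q) = 2 * pi * of_int a"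
    using ab by (simp add: m_def)
  finally have "\<omega> ^ m = 1"
    by (simp add: cis_multiple_2pi)
  have "algebraic \<omega>"
  proof (rule algebraic_root)
    show "poly (monom 1 m) \<omega> = 1" using \<open>\<omega> ^ m = 1\<close> by (simp add: poly_monom)
    show "degree (monom (1 :: complex) m) > 0" using ab by (simp add: degree_monom_eq m_def)
  qed (simp_all add: rat_imp_algebraic degree_monom_eq)
  hence "algebraic ((\<omega> + cnj \<omega>) / 2)"
    by (simp add: algebraic_divide algebraic_add rat_imp_algebraic)
  also have "(\<omega> + cnj \<omega>) / 2 = of_real (cos (pi * q))"
    by (simp add: \<omega>_def complex_eq_iff)
  finally show ?thesis by simp
qed

lemma algebraic_cot_rat_pi:
  assumes "q \<in> \<rat>" "0 \<le> q" "q \<le> 1"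
  shows "algebraic (cot (pi * q))"
proof -
  \<comment> \<open>The range of \<open>q\<close> fixes the sign of the sine, which is therefore the
    nonnegative square root of an algebraic number.\<close>
  have "sin (pi * q) \<ge> 0"
    using assms by (intro sin_ge_zero) (auto simp: mult_left_le)
  hence "sin (pi * q) = sqrt (1 - cos (pi * q) ^ 2)"
    by (simp add: sin_squared_eq[symmetric])
  also have "algebraic \<dots>"
    unfolding power2_eq_square using assms(1)
    by (simp add: algebraic_sqrt algebraic_diff algebraic_mult algebraic_cos_rat_pi
        rat_imp_algebraic)
  finally show ?thesis
    unfolding cot_def using assms(1) by (intro algebraic_divide algebraic_cos_rat_pi)
qed

section \<open>Reflection formulas for polygamma functions\<close>

text \<open>This is the logarithmic derivative of the reflection formula for \<open>rGamma\<close>,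
  since \<open>rGamma\<close> has derivative \<open>- rGamma x * Digamma x\<close>.\<close>

lemma Digamma_reflection_real:
  fixes x :: real
  assumes "0 < x" "x < 1"
  shows "Digamma (1 - x) - Digamma x = pi * cot (pi * x)"
proof -
  \<comment> \<open>Obtained from the complex formula for every real \<open>x\<close>, so both sides
    agree as functions and their derivatives may be equated.\<close>
  have reflection: "rGamma x * rGamma (1 - x) = sin (pi * x) / pi" for x :: real
  proof -
    have "of_real (rGamma x * rGamma (1 - x)) = (of_real (sin (pi * x) / pi) :: complex)"
      using rGamma_reflection_complex[of "of_real x"]
      by (simp flip: rGamma_complex_of_real sin_of_real)
    thus ?thesis by (simp only: of_real_eq_iff)
  qed
  have "x \<notin> \<int>\<^sub>\<le>\<^sub>0" "1 - x \<notin> \<int>\<^sub>\<le>\<^sub>0"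
    using assms by (auto elim!: nonpos_Ints_cases)
  hence "((\<lambda>x. rGamma x * rGamma (1 - x)) has_field_derivative
      rGamma x * rGamma (1 - x) * (Digamma (1 - x) - Digamma x)) (at x)"
    by (auto intro!: derivative_eq_intros simp: algebra_simps)
  moreover have "((\<lambda>x. sin (pi * x) / pi) has_field_derivative cos (pi * x)) (at x)"
    by (auto intro!: derivative_eq_intros)
  ultimately have "sin (pi * x) / pi * (Digamma (1 - x) - Digamma x) = cos (pi * x)"
    using DERIV_unique by (simp add: reflection)
  moreover have "sin (pi * x) > 0"
    using assms by (intro sin_gt_zero) auto
  ultimately show ?thesis
    by (simp add: cot_def field_simps)
qed

text \<open>One polynomial must serve all of (0, 1): the induction step differentiates the identity
  in \<open>x\<close> with \<open>p\<close> fixed.\<close>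

lemma Polygamma_reflection_real:
  "\<exists>p :: real poly. (\<forall>i. coeff p i \<in> \<rat>) \<and> (\<forall>x\<in>{0<..<1}.
     (- 1) ^ n * Polygamma n (1 - x) - Polygamma n x = pi ^ Suc n * poly p (cot (pi * x)))"
proof (induction n)
  case 0
  have "coeff [:0, 1 :: real:] i \<in> \<rat>" for i
    by (simp add: coeff_pCons split: nat.split)
  thus ?case
    by (intro exI[of _ "[:0, 1:]"]) (simp add: Digamma_reflection_real)
next
  case (Suc n)
  then obtain p :: "real poly" where p: "\<And>i. coeff p i \<in> \<rat>"
    and eq: "\<And>x. 0 < x \<Longrightarrow> x < 1 \<Longrightarrow>
      (- 1) ^ n * Polygamma n (1 - x) - Polygamma n x = pi ^ Suc n * poly p (cot (pi * x))"
    unfolding greaterThanLessThan_iff Ball_def by blast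
  \<comment> \<open>The first factor is -(1 + X^2), the derivative of the cotangent in terms of X =
    cot; the remaining chain-rule factor is pi.\<close>
  define q where "q = [:- 1, 0, - 1:] * pderiv p"
  have "coeff [:- 1, 0, - 1 :: real:] i \<in> \<rat>" for i
    by (simp add: coeff_pCons split: nat.split)
  hence "coeff q i \<in> \<rat>" for i
    unfolding q_def coeff_mult coeff_pderiv using p by (intro Rats_sum Rats_mult) auto
  moreover have "(- 1) ^ Suc n * Polygamma (Suc n) (1 - x) - Polygamma (Suc n) x
      = pi ^ Suc (Suc n) * poly q (cot (pi * x))" if "0 < x" "x < 1" for x
  proof -
    have "x \<notin> \<int>\<^sub>\<le>\<^sub>0" "1 - x \<notin> \<int>\<^sub>\<le>\<^sub>0"
      using that by (auto elim!: nonpos_Ints_cases)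
    \<comment> \<open>The inner derivative -1 of \<open>1 - x\<close> raises
      \<open>(- 1) ^ n\<close> to \<open>(- 1) ^ Suc n\<close>.\<close>
    hence 1: "((\<lambda>x. (- 1) ^ n * Polygamma n (1 - x) - Polygamma n x) has_field_derivative
        (- 1) ^ Suc n * Polygamma (Suc n) (1 - x) - Polygamma (Suc n) x) (at x)"
      by (auto intro!: derivative_eq_intros DERIV_chain2[OF has_field_derivative_Polygamma])
    have sin: "sin (pi * x) \<noteq> 0"
      using that sin_gt_zero[of "pi * x"] by simp
    have "inverse (sin (pi * x) ^ 2) = 1 + cot (pi * x) ^ 2"
      using sin sin_cos_squared_add[of "pi * x"] by (simp add: cot_def field_simps)
    hence cot: "(cot has_field_derivative - (1 + cot (pi * x) ^ 2)) (at (pi * x))"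
      using DERIV_cot[OF sin] by simp
    have "((\<lambda>x. pi * x) has_field_derivative pi) (at x)"
      by (auto intro!: derivative_eq_intros)
    from DERIV_cmult[OF DERIV_chain2[OF poly_DERIV DERIV_chain2[OF cot this]], of "pi ^ Suc n" p]
    have "((\<lambda>x. pi ^ Suc n * poly p (cot (pi * x))) has_field_derivative
        pi ^ Suc (Suc n) * poly q (cot (pi * x))) (at x)"
      by (rule DERIV_cong) (simp add: q_def power2_eq_square algebra_simps)
    \<comment> \<open>The identity is known only on (0, 1); openness of this interval suffices to
      transfer the derivative.\<close>
    hence 2: "((\<lambda>x. (- 1) ^ n * Polygamma n (1 - x) - Polygamma n x) has_field_derivative
        pi ^ Suc (Suc n) * poly q (cot (pi * x))) (at x)"
      by (rule has_field_derivative_transform_within_open[of _ _ _ "{0<..<1}"])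
        (use that eq in auto)
    show ?thesis using DERIV_unique[OF 1 2] .
  qed
  ultimately show ?case
    by (intro exI[of _ q]) simp
qed

section \<open>Evaluation of the series by polygamma functions\<close>

lemma infsum_int_split:
  fixes f :: "int \<Rightarrow> real"
  assumes "f summable_on UNIV"
  shows "infsum f UNIV = (\<Sum>\<^sub>\<infinity>i. f (int i)) + (\<Sum>\<^sub>\<infinity>i. f (- int (Suc i)))"
proof -
  have UNIV: "(UNIV :: int set) = range int \<union> range (\<lambda>i. - int (Suc i))"
  proof (intro equalityI subsetI)
    fix j :: int
    show "j \<in> range int \<union> range (\<lambda>i. - int (Suc i))"
      by (cases j rule: int_cases) blast+
  qed simp
  have "infsum f UNIV = infsum f (range int) + infsum f (range (\<lambda>i. - int (Suc i)))"
    unfolding UNIV using assms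
    by (intro infsum_Un_disjoint) (auto intro: summable_on_subset_banach)
  thus ?thesis
    by (simp add: infsum_reindex inj_on_def o_def)
qed

lemma infsum_Polygamma:
  fixes x :: real
  assumes "0 < x" "n > 0"
  shows "(\<Sum>\<^sub>\<infinity>i. 1 / (x + real i) ^ Suc n) = (- 1) ^ Suc n * Polygamma n x / fact n"
proof -
  let ?s = "(- 1) ^ Suc n * Polygamma n x / fact n"
  have sums: "(\<lambda>i. 1 / (x + real i) ^ Suc n) sums ?s"
    using Polygamma_LIMSEQ[of x n] assms by (simp add: inverse_eq_divide)
  \<comment> \<open>All terms are positive, so convergence of the ordered series is absolute and
    gives the unordered sum.\<close>
  hence "((\<lambda>i. 1 / (x + real i) ^ Suc n) has_sum ?s) UNIV"
    using assms by (intro norm_summable_imp_has_sum) (auto simp: sums_iff)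
  thus ?thesis by (rule infsumI)
qed

text \<open>Nonnegative indices give k(x + i) and negative ones -k(1 - x + i). Factoring out
  \<open>(- 1) ^ n\<close> leaves exactly the combination in the reflection formula.\<close>

lemma S_eq_Polygamma:
  fixes k l :: int
  assumes "n > 0" "1 \<le> l" "l < k"
  defines "x \<equiv> real_of_int l / real_of_int k"
  shows "S (Suc n) k l = ((- 1) ^ n * Polygamma n (1 - x) - Polygamma n x)
    * (- 1) ^ n / (fact n * real_of_int k ^ Suc n)"
proof -
  let ?f = "\<lambda>j::int. 1 / real_of_int (j * k + l) ^ Suc n"
  have k: "real_of_int k > 0" using assms by simp
  have x: "0 < x" "x < 1" using assms by (simp_all add: x_def)
  have f1: "?f (int i) = inverse (real_of_int k ^ Suc n) * (1 / (x + real i) ^ Suc n)" for i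
  proof -
    have "real_of_int (int i * k + l) = real_of_int k * (x + real i)"
      using k by (simp add: x_def field_simps)
    thus ?thesis by (simp only: power_mult_distrib) (simp add: divide_inverse)
  qed
  have f2: "?f (- int (Suc i)) = (- 1) ^ Suc n * inverse (real_of_int k ^ Suc n)
      * (1 / (1 - x + real i) ^ Suc n)" for i
  proof -
    have "real_of_int (- int (Suc i) * k + l) = (- 1) * (real_of_int k * (1 - x + real i))"
      using k by (simp add: x_def field_simps)
    thus ?thesis
      by (simp only: power_mult_distrib) (cases "even n"; simp add: divide_inverse)
  qed
  have "?f summable_on UNIV"
    using assms by (intro abs_summable_summable[OF S_abs_summable]) auto
  hence "S (Suc n) k l = (\<Sum>\<^sub>\<infinity>i. ?f (int i)) + (\<Sum>\<^sub>\<infinity>i. ?f (- int (Suc i)))"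
    unfolding S_def by (rule infsum_int_split)
  also have "\<dots> = inverse (real_of_int k ^ Suc n) * ((- 1) ^ Suc n * Polygamma n x / fact n)
      + (- 1) ^ Suc n * inverse (real_of_int k ^ Suc n) * ((- 1) ^ Suc n * Polygamma n (1 - x) / fact n)"
    unfolding f1 f2 using x assms by (simp only: infsum_cmult_right' infsum_Polygamma diff_gt_0_iff_gt)
  also have "\<dots> = ((- 1) ^ n * Polygamma n (1 - x) - Polygamma n x)
      * (- 1) ^ n / (fact n * real_of_int k ^ Suc n)"
    using k by (simp add: field_simps flip: power_add mult_2)
  finally show ?thesis .
qed

text \<open>The reflection formula of order n - 1 carries exactly \<open>pi ^ n\<close>, which
  cancels and leaves a rational multiple of a rational polynomial in an algebraic cotangent.\<close>

lemma algebraic_S: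
  fixes k l :: int
  assumes "n \<ge> 2" "1 \<le> l" "l < k"
  shows "algebraic (1 / pi ^ n * S n k l)"
proof -
  obtain m where m: "n = Suc m" "m > 0" using assms(1) by (cases n) auto
  obtain p :: "real poly" where p: "\<And>i. coeff p i \<in> \<rat>"
    "\<And>x. 0 < x \<Longrightarrow> x < 1 \<Longrightarrow>
      (- 1) ^ m * Polygamma m (1 - x) - Polygamma m x = pi ^ Suc m * poly p (cot (pi * x))"
    using Polygamma_reflection_real[of m] unfolding greaterThanLessThan_iff Ball_def by blast
  define x where "x = real_of_int l / real_of_int k"
  have x: "x \<in> \<rat>" "0 < x" "x < 1" using assms by (simp_all add: x_def)
  have "1 / pi ^ n * S n k l = poly p (cot (pi * x)) * ((- 1) ^ m / (fact m * real_of_int k ^ Suc m))"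
    using S_eq_Polygamma[OF m(2) assms(2,3)] p(2)[OF x(2,3)] by (simp add: m x_def)
  also have "algebraic \<dots>"
  proof (intro algebraic_mult algebraic_poly algebraic_cot_rat_pi)
    have "(fact m :: real) \<in> \<rat>" by (metis Rats_of_nat of_nat_fact)
    thus "algebraic ((- 1) ^ m / (fact m * real_of_int k ^ Suc m))"
      by (intro rat_imp_algebraic Rats_divide Rats_mult Rats_power) auto
  qed (use x p(1) in auto)
  finally show ?thesis .
qed

section \<open>Alternating series and conclusion\<close>

lemma S_hat_eq_S_diff:
  assumes "n \<ge> 2" "k \<noteq> 0"
  shows "S_hat n k l = S n (2 * k) l - S n (2 * k) (l + k)"
proof -
  let ?f = "\<lambda>j::int. (- 1) powi j / real_of_int (j * k + l) ^ n"
  have UNIV: "(UNIV :: int set) = range (\<lambda>j. 2 * j) \<union> range (\<lambda>j. 2 * j + 1)"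
  proof (intro equalityI subsetI)
    fix j :: int
    show "j \<in> range (\<lambda>j. 2 * j) \<union> range (\<lambda>j. 2 * j + 1)"
      by (cases "even j") (auto elim!: evenE oddE)
  qed simp
  \<comment> \<open>Absolute convergence makes the even and odd subfamilies summable, so the sum may
    be split by parity.\<close>
  have "?f summable_on UNIV"
    using S_hat_abs_summable[OF assms] by (rule abs_summable_summable)
  hence "infsum ?f UNIV = infsum ?f (range (\<lambda>j. 2 * j)) + infsum ?f (range (\<lambda>j. 2 * j + 1))"
    by (subst (1) UNIV, intro infsum_Un_disjoint) (auto intro: summable_on_subset_banach, presburger)
  also have "\<dots> = (\<Sum>\<^sub>\<infinity>j. ?f (2 * j)) + (\<Sum>\<^sub>\<infinity>j. ?f (2 * j + 1))"
    by (simp add: infsum_reindex inj_on_def o_def)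
  also have "(\<lambda>j. ?f (2 * j)) = (\<lambda>j. 1 / real_of_int (j * (2 * k) + l) ^ n)"
    by (simp add: power_int_minus_left mult.assoc mult.left_commute[of 2])
  also have "(\<lambda>j. ?f (2 * j + 1)) = (\<lambda>j. - (1 / real_of_int (j * (2 * k) + (l + k)) ^ n))"
    by (simp add: power_int_minus_left algebra_simps)
  finally show ?thesis
    by (simp add: S_def S_hat_def infsum_uminus)
qed

theorem theorem2:
  fixes n :: nat and k l :: int
  assumes "n \<ge> 2" and "k \<ge> 2" and "1 \<le> l" and "l \<le> k - 1"
  shows "algebraic (1 / pi ^ n * S n k l) \<and> algebraic (1 / pi ^ n * S_hat n k l)"
proof
  show "algebraic (1 / pi ^ n * S n k l)"
    using assms by (intro algebraic_S) auto
  have "1 / pi ^ n * S_hat n k l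
      = 1 / pi ^ n * S n (2 * k) l - 1 / pi ^ n * S n (2 * k) (l + k)"
    using assms by (simp add: S_hat_eq_S_diff right_diff_distrib)
  \<comment> \<open>Both \<open>l\<close> and \<open>l + k\<close> lie strictly between 0 and
    \<open>2 * k\<close>, as \<open>algebraic_S\<close> requires for the doubled modulus.\<close>
  also have "algebraic \<dots>"
    using assms by (intro algebraic_diff algebraic_S) auto
  finally show "algebraic (1 / pi ^ n * S_hat n k l)" .
qed

end
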